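(* Every cosimple zonotope has lattice-width three or more. Conversely, if $Z=\sum_{i=1}^n[\mathbf 0,\mathbf u_i]$ is a lattice $d$-zonotope of lattice-width three or more, $Z$ is not a parallelepiped, and its generators $\mathbf u_1,\dots,\mathbf u_n\in\mathbb{Z}^d$ span the lattice $\mathbb{Z}^d$ (over $\mathbb{Z}$), then $Z$ is cosimple.
   Context: A lattice $d$-zonotope is a $d$-dimensional zonotope in $\mathbb{R}^d$ with finitely many generators in $\mathbb{Z}^d$. A finite collection of vectors $\mathbf u_1,\dots,\mathbf u_n\in\mathbb{Z}^d$ that linearly spans $\mathbb{R}^d$ is cosimple if there is a linear dependence $\sum_i\lambda_i\mathbf u_i=\mathbf 0$ whose coefficients are all non-zero and have pairwise different absolute values; a zonotope $\sum_i[\mathbf 0,\mathbf u_i]$ is cosimple if its collection of generators is. The lattice-width of a convex body $C\subseteq\mathbb{R}^d$ is the minimum, over $\mathbf z\in\mathbb{Z}^d\setminus\{\mathbf 0\}$, of $\max_{\mathbf x\in C}\mathbf z^\intercal\mathbf x-\min_{\mathbf x\in C}\mathbf z^\intercal\mathbf x$. *)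

theory Defs
  imports "HOL-Analysis.Analysis" "HOL-Library.Set_Algebras"
begin

text \<open>
  The ambient space is \<open>real ^ 'd\<close> with \<open>CARD('d) \<ge> 1\<close>. A finite collection of \<open>n\<close> vectors is a
  family \<open>u\<close>, of which only the values at the indices \<open>1, \<dots>, n\<close> matter; repetitions, parallel
  vectors and zero vectors are allowed.
\<close>

definition int_lattice :: "(real ^ 'd) set" where
  "int_lattice = {x. \<forall>i. x $ i \<in> \<int>}"

definition int_span :: "nat \<Rightarrow> (nat \<Rightarrow> real ^ 'd) \<Rightarrow> (real ^ 'd) set" where
  "int_span n u = {(\<Sum>i=1..n. of_int (c i) *\<^sub>R u i) | c :: nat \<Rightarrow> int. True}"

text \<open>The sums of segments below are Minkowski sums.\<close>

definition zonotope :: "nat \<Rightarrow> (nat \<Rightarrow> real ^ 'd) \<Rightarrow> (real ^ 'd) set" where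
  "zonotope n u = (\<Sum>i=1..n. closed_segment 0 (u i))"

definition lattice_zonotope :: "nat \<Rightarrow> (nat \<Rightarrow> real ^ 'd) \<Rightarrow> bool" where
  "lattice_zonotope n u \<longleftrightarrow>
     (\<forall>i\<in>{1..n}. u i \<in> int_lattice) \<and> aff_dim (zonotope n u) = int CARD('d)"

text \<open>
  Being a parallelepiped is a property of the point set, not of a chosen family of generators.
\<close>

definition parallelepiped :: "(real ^ 'd) set \<Rightarrow> bool" where
  "parallelepiped P \<longleftrightarrow>
     (\<exists>t B. independent B \<and> card B = CARD('d) \<and>
        P = (\<lambda>x. t + x) ` (\<Sum>b\<in>B. closed_segment 0 b))"

definition cosimple :: "nat \<Rightarrow> (nat \<Rightarrow> real ^ 'd) \<Rightarrow> bool" where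
  "cosimple n u \<longleftrightarrow>
     (\<forall>i\<in>{1..n}. u i \<in> int_lattice) \<and>
     span (u ` {1..n}) = UNIV \<and>
     (\<exists>c :: nat \<Rightarrow> real.
        (\<Sum>i=1..n. c i *\<^sub>R u i) = 0 \<and>
        (\<forall>i\<in>{1..n}. c i \<noteq> 0) \<and>
        (\<forall>i\<in>{1..n}. \<forall>j\<in>{1..n}. i \<noteq> j \<longrightarrow> \<bar>c i\<bar> \<noteq> \<bar>c j\<bar>))"

text \<open>
  For a convex body (compact, with non-empty interior) all the suprema and infima below are
  attained, so that they are the maxima and minima of the usual definition.
\<close>

definition lattice_width :: "(real ^ 'd) set \<Rightarrow> real" where
  "lattice_width C =
     (INF z\<in>int_lattice - {0}. (SUP x\<in>C. z \<bullet> x) - (INF x\<in>C. z \<bullet> x))"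

end

theory Submission
  imports Defs
begin

text \<open>
  The width of \<open>zonotope n u\<close> in direction \<open>z\<close> is \<open>\<Sum>i. \<bar>z \<bullet> u i\<bar>\<close>. For an integral \<open>z\<close> this is a sum
  of non-negative integers, and it is at most \<open>2\<close> exactly when the integer vector \<open>(z \<bullet> u i)\<^sub>i\<close>
  is zero, or of the form \<open>\<plusminus>e\<^sub>i\<close>, \<open>\<plusminus>2 e\<^sub>i\<close> or \<open>\<plusminus>e\<^sub>i \<plusminus> e\<^sub>j\<close>. This vector is orthogonal to all linear
  dependences among the \<open>u i\<close>, so the last three cases are excluded by a cosimple dependence and the
  first one by spanning. Conversely, a generic dependence is cosimple unless the space of
  dependences is orthogonal to some \<open>e\<^sub>i\<close> or \<open>e\<^sub>i \<plusminus> e\<^sub>j\<close>; as the \<open>u i\<close> generate the lattice, such an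
  integer vector is \<open>(z \<bullet> u i)\<^sub>i\<close> for an integral \<open>z\<close>, whose width is then at most \<open>2\<close>.
\<close>

lemma zonotope_alt:
  "zonotope n u = {\<Sum>i=1..n. t i *\<^sub>R u i | t. \<forall>i\<in>{1..n}. 0 \<le> t i \<and> t i \<le> 1}"
proof -
  have "zonotope n u = {sum s {1..n} | s. \<forall>i\<in>{1..n}. s i \<in> closed_segment 0 (u i)}"
    unfolding zonotope_def by (rule set_sum_alt) simp
  also have "\<dots> = {\<Sum>i=1..n. t i *\<^sub>R u i | t. \<forall>i\<in>{1..n}. 0 \<le> t i \<and> t i \<le> 1}"
  proof safe
    fix s assume "\<forall>i\<in>{1..n}. s i \<in> closed_segment 0 (u i)"
    then have "\<forall>i\<in>{1..n}. \<exists>t. 0 \<le> t \<and> t \<le> 1 \<and> s i = t *\<^sub>R u i"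
      by (auto simp: closed_segment_def)
    then obtain t where "\<forall>i\<in>{1..n}. 0 \<le> t i \<and> t i \<le> 1 \<and> s i = t i *\<^sub>R u i"
      by metis
    then show "\<exists>t. sum s {1..n} = (\<Sum>i=1..n. t i *\<^sub>R u i) \<and> (\<forall>i\<in>{1..n}. 0 \<le> t i \<and> t i \<le> 1)"
      by (intro exI[of _ t]) auto
  next
    fix t :: "nat \<Rightarrow> real" assume "\<forall>i\<in>{1..n}. 0 \<le> t i \<and> t i \<le> 1"
    then show "\<exists>s. (\<Sum>i=1..n. t i *\<^sub>R u i) = sum s {1..n} \<and>
        (\<forall>i\<in>{1..n}. s i \<in> closed_segment 0 (u i))"
      by (intro exI[of _ "\<lambda>i. t i *\<^sub>R u i"]) (auto simp: closed_segment_def)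
  qed
  finally show ?thesis .
qed

lemma zonotope_SUP_inner:
  "(SUP x\<in>zonotope n u. z \<bullet> x) = (\<Sum>i=1..n. max 0 (z \<bullet> u i))"
proof (rule cSup_eq_maximum)
  \<comment> \<open>The maximising vertex: keep exactly the generators on which \<open>z\<close> is
    positive.\<close>
  let ?t = "\<lambda>i. of_bool (z \<bullet> u i > 0) :: real"
  have "(\<Sum>i=1..n. ?t i *\<^sub>R u i) \<in> zonotope n u"
    unfolding zonotope_alt by (intro CollectI exI[of _ ?t]) auto
  moreover have "z \<bullet> (\<Sum>i=1..n. ?t i *\<^sub>R u i) = (\<Sum>i=1..n. max 0 (z \<bullet> u i))"
    unfolding inner_sum_right by (rule sum.cong) (simp_all add: of_bool_def max_def)
  ultimately show "(\<Sum>i=1..n. max 0 (z \<bullet> u i)) \<in> (\<bullet>) z ` zonotope n u"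
    by (rule rev_image_eqI[OF _ sym])
next
  fix y assume "y \<in> (\<bullet>) z ` zonotope n u"
  then obtain t where t: "\<forall>i\<in>{1..n}. 0 \<le> t i \<and> t i \<le> 1" "y = (\<Sum>i=1..n. t i * (z \<bullet> u i))"
    unfolding zonotope_alt by (auto simp: inner_sum_right)
  have "t i * (z \<bullet> u i) \<le> max 0 (z \<bullet> u i)" if "i \<in> {1..n}" for i
  proof -
    have "t i * (z \<bullet> u i) \<le> t i * max 0 (z \<bullet> u i)"
      using t(1) that by (intro mult_left_mono) auto
    also have "\<dots> \<le> max 0 (z \<bullet> u i)"
      using t(1) that by (intro mult_left_le_one_le) auto
    finally show ?thesis .
  qed
  then show "y \<le> (\<Sum>i=1..n. max 0 (z \<bullet> u i))"
    unfolding t(2) by (rule sum_mono)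
qed

lemma zonotope_width:
  "(SUP x\<in>zonotope n u. z \<bullet> x) - (INF x\<in>zonotope n u. z \<bullet> x) = (\<Sum>i=1..n. \<bar>z \<bullet> u i\<bar>)"
proof -
  have "(INF x\<in>zonotope n u. z \<bullet> x) = - (SUP x\<in>zonotope n u. - z \<bullet> x)"
    by (simp add: Inf_real_def image_image)
  also have "\<dots> = - (\<Sum>i=1..n. max 0 (- z \<bullet> u i))"
    by (simp only: zonotope_SUP_inner)
  \<comment> \<open>Each generator contributes \<open>max 0 a + max 0 (- a) = \<bar>a\<bar>\<close>
    with \<open>a = z \<bullet> u i\<close>.\<close>
  finally show ?thesis
    unfolding zonotope_SUP_inner by (auto simp flip: sum.distrib intro!: sum.cong)
qed

lemma axis_in_int_lattice: "axis j 1 \<in> int_lattice"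
  by (simp add: int_lattice_def axis_def)

lemma int_lattice_inner:
  assumes "x \<in> int_lattice" "y \<in> int_lattice"
  shows "x \<bullet> y \<in> \<int>"
  using assms by (auto simp: int_lattice_def inner_vec_def intro!: Ints_sum Ints_mult)

lemma lattice_width_zonotope_ge_iff:
  fixes u :: "nat \<Rightarrow> real ^ 'd"
  shows "lattice_width (zonotope n u) \<ge> w \<longleftrightarrow>
    (\<forall>z\<in>int_lattice - {0}. (\<Sum>i=1..n. \<bar>z \<bullet> u i\<bar>) \<ge> w)"
proof -
  \<comment> \<open>An arbitrary axis vector shows that the infimum ranges over a non-empty
    set.\<close>
  have "axis undefined 1 \<in> int_lattice - {0 :: real ^ 'd}"
    by (simp add: axis_in_int_lattice axis_eq_0_iff)
  then have "int_lattice - {0 :: real ^ 'd} \<noteq> {}"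
    by blast
  moreover have "bdd_below ((\<lambda>z. \<Sum>i=1..n. \<bar>z \<bullet> u i\<bar>) ` (int_lattice - {0}))"
    by (intro bdd_belowI2[of _ 0] sum_nonneg) simp
  ultimately show ?thesis
    unfolding lattice_width_def zonotope_width by (rule le_cINF_iff)
qed

text \<open>Orthogonality to \<open>c\<close> forces a second non-zero entry. A third one gives
  three integers of absolute value at least 1. With only two, their products with \<open>c\<close>
  cancel, so the differing absolute values in \<open>c\<close> make the two entries differ in
  absolute value, and 1 + 2 is the smallest sum.\<close>

lemma sum_abs_ge_3:
  fixes a c :: "'i \<Rightarrow> real"
  assumes "finite I" and int: "\<forall>i\<in>I. a i \<in> \<int>" and nz: "\<exists>i\<in>I. a i \<noteq> 0"
    and orth: "(\<Sum>i\<in>I. c i * a i) = 0"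
    and c: "\<forall>i\<in>I. c i \<noteq> 0" "\<forall>i\<in>I. \<forall>j\<in>I. i \<noteq> j \<longrightarrow> \<bar>c i\<bar> \<noteq> \<bar>c j\<bar>"
  shows "(\<Sum>i\<in>I. \<bar>a i\<bar>) \<ge> 3"
proof -
  obtain i where i: "i \<in> I" "a i \<noteq> 0" using nz by blast
  have "\<exists>j\<in>I - {i}. c j * a j \<noteq> 0"
  proof (rule ccontr)
    assume "\<not> ?thesis"
    then have "(\<Sum>j\<in>I - {i}. c j * a j) = 0" by (intro sum.neutral) auto
    then show False using orth i c(1) \<open>finite I\<close> by (simp add: sum.remove)
  qed
  then obtain j where j: "j \<in> I" "j \<noteq> i" "a j \<noteq> 0" by auto
  have ge1: "\<bar>a k\<bar> \<ge> 1" if "k \<in> I" "a k \<noteq> 0" for k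
    using that int by (simp add: Ints_nonzero_abs_ge1)
  have split: "sum f I = f i + f j + sum f (I - {i} - {j})" for f :: "'i \<Rightarrow> real"
    using i j \<open>finite I\<close> by (simp add: sum.remove[of _ i] sum.remove[of _ j])
  show ?thesis
  proof (cases "\<exists>k\<in>I - {i} - {j}. a k \<noteq> 0")
    case True
    then obtain k where k: "k \<in> I - {i} - {j}" "a k \<noteq> 0" by blast
    then have "\<bar>a k\<bar> \<le> (\<Sum>i\<in>I - {i} - {j}. \<bar>a i\<bar>)"
      using \<open>finite I\<close> by (intro member_le_sum) auto
    then show ?thesis
      using ge1[of i] ge1[of j] ge1[of k] i j k split[of "\<lambda>i. \<bar>a i\<bar>"] by auto
  next
    case False
    then have "(\<Sum>k\<in>I - {i} - {j}. c k * a k) = 0" by (intro sum.neutral) auto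
    then have "c i * a i = - (c j * a j)"
      using orth split[of "\<lambda>i. c i * a i"] by simp
    then have eq: "\<bar>c i\<bar> * \<bar>a i\<bar> = \<bar>c j\<bar> * \<bar>a j\<bar>"
      by (metis abs_minus_cancel abs_mult)
    have "\<bar>a i\<bar> \<noteq> \<bar>a j\<bar>"
      using eq c(2) i j by auto
    moreover obtain m k :: int where "a i = m" "a j = k"
      using int i j by (metis Ints_cases)
    ultimately have "of_int (\<bar>m\<bar> + \<bar>k\<bar>) \<ge> (of_int 3 :: real)"
      using i j unfolding of_int_le_iff by auto
    then have "\<bar>a i\<bar> + \<bar>a j\<bar> \<ge> 3"
      using \<open>a i = m\<close> \<open>a j = k\<close> by simp
    then show ?thesis
      using split[of "\<lambda>i. \<bar>a i\<bar>"] sum_nonneg[of "I - {i} - {j}" "\<lambda>i. \<bar>a i\<bar>"] by linarith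
  qed
qed

lemma cosimple_width_ge_3:
  assumes "cosimple n u" "z \<in> int_lattice" "z \<noteq> 0"
  shows "(\<Sum>i=1..n. \<bar>z \<bullet> u i\<bar>) \<ge> 3"
proof -
  obtain c :: "nat \<Rightarrow> real" where c: "(\<Sum>i=1..n. c i *\<^sub>R u i) = 0" "\<forall>i\<in>{1..n}. c i \<noteq> 0"
      "\<forall>i\<in>{1..n}. \<forall>j\<in>{1..n}. i \<noteq> j \<longrightarrow> \<bar>c i\<bar> \<noteq> \<bar>c j\<bar>"
    using assms(1) unfolding cosimple_def by blast
  show ?thesis
  proof (rule sum_abs_ge_3)
    show "\<forall>i\<in>{1..n}. z \<bullet> u i \<in> \<int>"
      using assms by (auto simp: cosimple_def intro: int_lattice_inner)
    show "\<exists>i\<in>{1..n}. z \<bullet> u i \<noteq> 0"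
    proof (rule ccontr)
      assume "\<not> ?thesis"
      \<comment> \<open>Orthogonality to the generators extends to their span, which contains
        \<open>z\<close> itself.\<close>
      then have "orthogonal z z"
        using assms(1) orthogonal_to_span[of z "u ` {1..n}" z]
        by (auto simp: cosimple_def orthogonal_def)
      then show False using assms(3) by (simp add: orthogonal_self)
    qed
    show "(\<Sum>i=1..n. c i * (z \<bullet> u i)) = 0"
      using arg_cong[OF c(1), of "(\<bullet>) z"] by (simp add: inner_sum_right)
  qed (use c in auto)
qed

text \<open>A real vector space is not a finite union of proper subspaces, here the kernels of the
  functionals in \<open>F\<close> on \<open>L\<close>. In the induction, a good vector
  \<open>x\<close> for \<open>F\<close> is moved along a \<open>y\<close> with
  \<open>g y \<noteq> 0\<close>.\<close>

lemma ex_nonvanishing_all: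
  fixes F :: "(('i \<Rightarrow> real) \<Rightarrow> real) set"
  assumes "finite F"
    and L: "x0 \<in> L" "\<And>x y t. x \<in> L \<Longrightarrow> y \<in> L \<Longrightarrow> (\<lambda>i. x i + t * y i) \<in> L"
    and lin: "\<And>f x y t. f \<in> F \<Longrightarrow> f (\<lambda>i. x i + t * y i) = f x + t * f y"
    and nz: "\<And>f. f \<in> F \<Longrightarrow> \<exists>x\<in>L. f x \<noteq> 0"
  shows "\<exists>x\<in>L. \<forall>f\<in>F. f x \<noteq> 0"
  using \<open>finite F\<close> lin nz
proof (induction F)
  case empty
  then show ?case using L(1) by blast
next
  case (insert g F)
  then obtain x where x: "x \<in> L" "\<forall>f\<in>F. f x \<noteq> 0" by auto
  obtain y where y: "y \<in> L" "g y \<noteq> 0" using insert.prems by blast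
  \<comment> \<open>Each \<open>f\<close> with \<open>f y \<noteq> 0\<close> rules out one value of
    \<open>t\<close>; if \<open>f y = 0\<close>, the move leaves \<open>f x\<close> unchanged, and
    the quotient merely excludes 0.\<close>
  have "finite ((\<lambda>f. - f x / f y) ` insert g F)"
    using insert.hyps by simp
  then obtain t where t: "t \<notin> (\<lambda>f. - f x / f y) ` insert g F"
    using ex_new_if_finite infinite_UNIV_char_0 by blast
  have "f (\<lambda>i. x i + t * y i) \<noteq> 0" if "f \<in> insert g F" for f
  proof (cases "f y = 0")
    case True
    then have "f (\<lambda>i. x i + t * y i) = f x" "f \<in> F"
      using insert.prems(1)[OF that] that y(2) by auto
    then show ?thesis using x(2) by simp
  next
    case False
    moreover have "t \<noteq> - f x / f y" using t that by blast
    ultimately show ?thesis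
      using insert.prems(1)[OF that] by (simp add: field_simps)
  qed
  then show ?case using L(2)[OF x(1) y(1)] by blast
qed

lemma sum_of_bool_scaleR:
  fixes v :: "'i \<Rightarrow> 'a :: real_vector"
  assumes "finite I" "k \<in> I"
  shows "(\<Sum>i\<in>I. of_bool (i = k) *\<^sub>R v i) = v k"
proof -
  have "(\<Sum>i\<in>I. of_bool (i = k) *\<^sub>R v i) = (\<Sum>i\<in>I. if i = k then v i else 0)"
    by (rule sum.cong) auto
  then show ?thesis using assms by simp
qed

text \<open>As \<open>a\<close> annihilates all real dependences, mapping \<open>u k\<close> to
  \<open>a k\<close> gives a well-defined linear functional. It is integral on the axis vectors,
  which are integer combinations of the \<open>u k\<close>, so an integral \<open>z\<close>
  represents it.\<close>

lemma int_span_realize: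
  fixes u :: "nat \<Rightarrow> real ^ 'd" and a :: "nat \<Rightarrow> real"
  assumes span: "int_lattice \<subseteq> int_span n u" and int: "\<And>i. a i \<in> \<int>"
    and orth: "\<And>c. (\<Sum>i=1..n. c i *\<^sub>R u i) = 0 \<Longrightarrow> (\<Sum>i=1..n. a i * c i) = 0"
  obtains z where "z \<in> int_lattice" "\<And>k. k \<in> {1..n} \<Longrightarrow> z \<bullet> u k = a k"
proof -
  have "\<exists>c :: nat \<Rightarrow> int. axis j 1 = (\<Sum>i=1..n. of_int (c i) *\<^sub>R u i)" for j
    using span axis_in_int_lattice[of j] by (auto simp: int_span_def)
  then obtain C :: "'d \<Rightarrow> nat \<Rightarrow> int"
    where C: "\<And>j. axis j 1 = (\<Sum>i=1..n. of_int (C j i) *\<^sub>R u i)"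
    by metis
  \<comment> \<open>Coordinate \<open>j\<close> is the value that the functional must take on
    \<open>axis j 1\<close>.\<close>
  define z :: "real ^ 'd" where "z = (\<chi> j. \<Sum>i=1..n. a i * of_int (C j i))"
  show thesis
  proof
    show "z \<in> int_lattice"
      using int by (auto simp: int_lattice_def z_def intro!: Ints_sum Ints_mult)
  next
    fix k assume k: "k \<in> {1..n}"
    \<comment> \<open>Expanding \<open>u k\<close> along the axes and then each axis in the
      generators expresses \<open>u k\<close> with coefficients \<open>?e\<close>; the difference
      from the trivial expression is a dependence to test \<open>a\<close> on.\<close>
    let ?e = "\<lambda>i. \<Sum>j\<in>UNIV. u k $ j * of_int (C j i)"
    have "u k = (\<Sum>j\<in>UNIV. u k $ j *\<^sub>R axis j 1)"
      by (metis basis_expansion scalar_mult_eq_scaleR)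
    also have "\<dots> = (\<Sum>j\<in>UNIV. \<Sum>i=1..n. (u k $ j * of_int (C j i)) *\<^sub>R u i)"
      by (simp add: C scaleR_sum_right)
    also have "\<dots> = (\<Sum>i=1..n. ?e i *\<^sub>R u i)"
      by (subst sum.swap) (simp add: scaleR_sum_left)
    finally have "(\<Sum>i=1..n. (?e i - of_bool (i = k)) *\<^sub>R u i) = 0"
      using sum_of_bool_scaleR[OF _ k, of u] by (simp add: scaleR_diff_left sum_subtractf)
    from orth[OF this] have "a k = (\<Sum>i=1..n. a i * ?e i)"
      using k by (simp add: right_diff_distrib sum_subtractf)
    also have "\<dots> = (\<Sum>j\<in>UNIV. \<Sum>i=1..n. a i * of_int (C j i) * u k $ j)"
      by (subst sum.swap) (simp add: sum_distrib_left mult_ac)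
    also have "\<dots> = z \<bullet> u k"
      by (simp add: z_def inner_vec_def sum_distrib_right)
    finally show "z \<bullet> u k = a k" ..
  qed
qed

lemma cosimpleI_width_ge_3:
  fixes u :: "nat \<Rightarrow> real ^ 'd"
  assumes lattice: "int_span n u = int_lattice"
    and width: "\<And>z. z \<in> int_lattice \<Longrightarrow> z \<noteq> 0 \<Longrightarrow> (\<Sum>i=1..n. \<bar>z \<bullet> u i\<bar>) \<ge> 3"
  shows "cosimple n u"
proof -
  let ?L = "{c. (\<Sum>i=1..n. c i *\<^sub>R u i) = 0}"
  \<comment> \<open>A triple stands for the forbidden equation \<open>c i + s * c j = 0\<close>:
    \<open>s = 0\<close> says \<open>c i = 0\<close>, and \<open>s = 1\<close> or
    \<open>s = -1\<close> says \<open>\<bar>c i\<bar> = \<bar>c j\<bar>\<close>. On the diagonal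
    only \<open>s = 0\<close> is kept, since \<open>c i - c i\<close> always vanishes.\<close>
  define T :: "(nat \<times> nat \<times> real) set"
    where "T = {(i, j, s) \<in> {1..n} \<times> {1..n} \<times> {-1, 0, 1}. i = j \<longrightarrow> s = 0}"
  have "finite T"
    by (rule finite_subset[of _ "{1..n} \<times> {1..n} \<times> {-1, 0, 1}"]) (auto simp: T_def)
  have nz: "\<exists>c\<in>?L. c i + s * c j \<noteq> 0" if "(i, j, s) \<in> T" for i j s
  proof (rule ccontr)
    assume neg: "\<not> ?thesis"
    \<comment> \<open>The coefficient vector of the functional. If it kills all dependences, it
      comes from an integral \<open>z\<close> of width at most 2.\<close>
    let ?a = "\<lambda>k. of_bool (k = i) + s * of_bool (k = j)"
    have ij: "i \<in> {1..n}" "j \<in> {1..n}" and s: "s \<in> {-1, 0, 1}" "i = j \<longrightarrow> s = 0"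
      using that by (auto simp: T_def)
    have "(\<Sum>k=1..n. ?a k * c k) = c i + s * c j" for c :: "nat \<Rightarrow> real"
      using ij by (simp add: distrib_right sum.distrib mult.assoc flip: sum_distrib_left)
    then have "(\<Sum>k=1..n. ?a k * c k) = 0" if "(\<Sum>k=1..n. c k *\<^sub>R u k) = 0" for c
      using neg that by auto
    moreover have "?a k \<in> \<int>" for k using s by auto
    ultimately obtain z where z: "z \<in> int_lattice" "\<And>k. k \<in> {1..n} \<Longrightarrow> z \<bullet> u k = ?a k"
      using int_span_realize[of n u ?a] lattice by blast
    \<comment> \<open>The value is 1, also for \<open>i = j\<close>, where \<open>s = 0\<close>;
      hence \<open>z\<close> is non-zero.\<close>
    have "z \<bullet> u i \<noteq> 0" using z(2)[OF ij(1)] s by auto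
    then have "(\<Sum>k=1..n. \<bar>z \<bullet> u k\<bar>) \<ge> 3" using width z(1) by force
    moreover have "(\<Sum>k=1..n. \<bar>z \<bullet> u k\<bar>) \<le> (\<Sum>k=1..n. of_bool (k = i) + of_bool (k = j))"
      using s z(2) by (intro sum_mono) auto
    moreover have "(\<Sum>k=1..n. of_bool (k = i) + of_bool (k = j)) = (2 :: real)"
      using ij by (simp add: sum.distrib)
    ultimately show False by simp
  qed
  have "\<exists>c\<in>?L. \<forall>f\<in>(\<lambda>(i, j, s) c. c i + s * c j) ` T. f c \<noteq> 0"
  proof (rule ex_nonvanishing_all[where ?x0.0 = "\<lambda>_. 0"])
    show "(\<lambda>i. x i + t * y i) \<in> ?L" if "x \<in> ?L" "y \<in> ?L" for x y t
      using that by (simp add: scaleR_add_left sum.distrib flip: scaleR_scaleR scaleR_sum_right)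
  qed (use \<open>finite T\<close> nz in \<open>auto simp: algebra_simps\<close>)
  then obtain c where c: "(\<Sum>i=1..n. c i *\<^sub>R u i) = 0"
    and c_nz: "\<And>i j s. (i, j, s) \<in> T \<Longrightarrow> c i + s * c j \<noteq> 0"
    by force
  have "c i \<noteq> 0" if "i \<in> {1..n}" for i
    using c_nz[of i i 0] that by (simp add: T_def)
  moreover have "\<bar>c i\<bar> \<noteq> \<bar>c j\<bar>" if "i \<in> {1..n}" "j \<in> {1..n}" "i \<noteq> j" for i j
    using c_nz[of i j 1] c_nz[of i j "-1"] that by (auto simp: T_def abs_eq_iff)
  moreover have "u i \<in> int_lattice" if "i \<in> {1..n}" for i
  proof -
    have "u i = (\<Sum>k=1..n. of_int (of_bool (k = i)) *\<^sub>R u k)"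
      using sum_of_bool_scaleR[OF _ that, of u] by simp
    then show ?thesis
      unfolding lattice[symmetric] int_span_def
      by (intro CollectI exI[of _ "\<lambda>k. of_bool (k = i)"] conjI TrueI)
  qed
  moreover have "span (u ` {1..n}) = UNIV"
  proof -
    have "axis j 1 \<in> span (u ` {1..n})" for j
    proof -
      obtain c :: "nat \<Rightarrow> int" where "axis j 1 = (\<Sum>i=1..n. of_int (c i) *\<^sub>R u i)"
        using axis_in_int_lattice[of j] unfolding lattice[symmetric] int_span_def by blast
      then show ?thesis
        by (simp only:) (intro span_sum span_scale span_base imageI)
    qed
    then have "(Basis :: (real ^ 'd) set) \<subseteq> span (u ` {1..n})"
      by (auto simp: Basis_vec_def)
    then show ?thesis
      by (metis span_Basis span_minimal subspace_span top.extremum_uniqueI)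
  qed
  ultimately show ?thesis
    using c unfolding cosimple_def by blast
qed

theorem corollary5p6:
  fixes n :: nat and u :: "nat \<Rightarrow> real ^ 'd"
  shows "(cosimple n u \<longrightarrow> lattice_width (zonotope n u) \<ge> 3) \<and>
    (lattice_zonotope n u \<and>
     lattice_width (zonotope n u) \<ge> 3 \<and>
     \<not> parallelepiped (zonotope n u) \<and>
     int_span n u = int_lattice
     \<longrightarrow> cosimple n u)"
  unfolding lattice_width_zonotope_ge_iff
  using cosimple_width_ge_3[of n u] cosimpleI_width_ge_3[of n u] by blast

end
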